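(* Let $\mathbb{H}$ be the $n$-dimensional Hilbert space $\ell_2^n$ ($n\ge 1$), with unit sphere $S_{\mathbb{H}}$. A nonempty set $A\subset S_{\mathbb{H}}$ is a minimal $\mathcal{K}$-set if and only if $A$ satisfies the following two conditions: (i) $A=\{x_1,x_2,\dots,x_n\}$, where $x_1,x_2,\dots,x_n$ are linearly independent; (ii) if $A=A_1\cup A_2$ with $A_1\neq\emptyset$ and $A_2\neq\emptyset$, then $A_1\not\perp_B A_2$.
   Context: For a Banach space $\mathbb{X}$ over the real or complex field and $x,y\in\mathbb{X}$, $x$ is Birkhoff-James orthogonal to $y$, written $x\perp_B y$, if $\|x+\lambda y\|\ge\|x\|$ for all scalars $\lambda$ (in an inner product space this is the usual orthogonality). For subsets $C,D$ of $\mathbb{X}$, $C\perp_B D$ means $u\perp_B v$ for all $u\in C$ and all $v\in D$; $C\not\perp_B D$ is its negation. A bounded linear operator $T:\mathbb{X}\to\mathbb{X}$ preserves Birkhoff-James orthogonality at $x\in\mathbb{X}$ if for every $y\in\mathbb{X}$, $x\perp_B y$ implies $Tx\perp_B Ty$. An isometry is a linear operator $T$ with $\|Tx\|=\|x\|$ for all $x$; scalar multiples include the multiple $0$. A nonempty set $A\subset S_{\mathbb{X}}$ is a $\mathcal{K}$-set if every bounded linear operator $T$ on $\mathbb{X}$ that preserves Birkhoff-James orthogonality at each point of $A$ is a scalar multiple of an isometry. A $\mathcal{K}$-set $A$ is minimal if whenever $B\subset A$ is a $\mathcal{K}$-set, $B=A$. *)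

theory Defs
  imports "HOL-Analysis.Analysis"
begin

text \<open>
  The scalar multiplication is an explicit parameter, so that the same definitions serve
  Banach spaces over the reals and over the complex numbers: the class \<open>banach\<close> only knows real
  scalars. They are meant for a multiplication \<open>scl\<close> that makes the space a vector space over
  the scalar field with \<open>norm (scl c x) = norm c * norm x\<close>.
\<close>

definition bj_orthogonal ::
  "('k::real_normed_field \<Rightarrow> 'v::banach \<Rightarrow> 'v) \<Rightarrow> 'v \<Rightarrow> 'v \<Rightarrow> bool" where
  "bj_orthogonal scl x y \<longleftrightarrow> (\<forall>c. norm (x + scl c y) \<ge> norm x)"

definition bj_orthogonal_sets ::
  "('k::real_normed_field \<Rightarrow> 'v::banach \<Rightarrow> 'v) \<Rightarrow> 'v set \<Rightarrow> 'v set \<Rightarrow> bool" where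
  "bj_orthogonal_sets scl C D \<longleftrightarrow> (\<forall>u\<in>C. \<forall>v\<in>D. bj_orthogonal scl u v)"

definition bounded_operator ::
  "('k::real_normed_field \<Rightarrow> 'v::banach \<Rightarrow> 'v) \<Rightarrow> ('v \<Rightarrow> 'v) \<Rightarrow> bool" where
  "bounded_operator scl T \<longleftrightarrow>
     Vector_Spaces.linear scl scl T \<and> (\<exists>K. \<forall>x. norm (T x) \<le> K * norm x)"

definition preserves_bj_at ::
  "('k::real_normed_field \<Rightarrow> 'v::banach \<Rightarrow> 'v) \<Rightarrow> ('v \<Rightarrow> 'v) \<Rightarrow> 'v \<Rightarrow> bool" where
  "preserves_bj_at scl T x \<longleftrightarrow>
     (\<forall>y. bj_orthogonal scl x y \<longrightarrow> bj_orthogonal scl (T x) (T y))"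

definition linear_isometry ::
  "('k::real_normed_field \<Rightarrow> 'v::banach \<Rightarrow> 'v) \<Rightarrow> ('v \<Rightarrow> 'v) \<Rightarrow> bool" where
  "linear_isometry scl U \<longleftrightarrow>
     Vector_Spaces.linear scl scl U \<and> (\<forall>x. norm (U x) = norm x)"

definition scalar_multiple_of_isometry ::
  "('k::real_normed_field \<Rightarrow> 'v::banach \<Rightarrow> 'v) \<Rightarrow> ('v \<Rightarrow> 'v) \<Rightarrow> bool" where
  "scalar_multiple_of_isometry scl T \<longleftrightarrow>
     (\<exists>c U. linear_isometry scl U \<and> T = (\<lambda>x. scl c (U x)))"

definition K_set ::
  "('k::real_normed_field \<Rightarrow> 'v::banach \<Rightarrow> 'v) \<Rightarrow> 'v set \<Rightarrow> bool" where
  "K_set scl A \<longleftrightarrow>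
     A \<noteq> {} \<and> A \<subseteq> sphere 0 1 \<and>
     (\<forall>T. bounded_operator scl T \<and> (\<forall>x\<in>A. preserves_bj_at scl T x) \<longrightarrow>
          scalar_multiple_of_isometry scl T)"

definition minimal_K_set ::
  "('k::real_normed_field \<Rightarrow> 'v::banach \<Rightarrow> 'v) \<Rightarrow> 'v set \<Rightarrow> bool" where
  "minimal_K_set scl A \<longleftrightarrow>
     K_set scl A \<and> (\<forall>B. B \<subseteq> A \<and> K_set scl B \<longrightarrow> B = A)"

end

theory Submission
  imports Defs
begin

text \<open>
  In an inner product space Birkhoff-James orthogonality is orthogonality for the inner product.
  Hence an operator \<open>T\<close> preserves it at a unit vector \<open>x\<close> exactly when
  \<open>\<langle>T x, T y\<rangle> = \<parallel>T x\<parallel>\<^sup>2 \<langle>x, y\<rangle>\<close> for all \<open>y\<close>, that is, when \<open>x\<close> is an eigenvector of \<open>T\<^sup>* T\<close> with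
  eigenvalue \<open>\<parallel>T x\<parallel>\<^sup>2\<close>; and \<open>T\<close> is a multiple of an isometry exactly when \<open>T\<^sup>* T\<close> is a scalar.
  Eigenvectors of the self-adjoint \<open>T\<^sup>* T\<close> that are not orthogonal share their eigenvalue. This
  gives a description of all K-sets (\<open>K_set_iff\<close>): a set of unit vectors is a K-set if and only if
  it spans the space and is irreducible, i.e. is not the union of two nonempty mutually
  orthogonal parts. Irreducibility makes the eigenvalue constant on the set, and spanning makes
  it constant on the space. Conversely, if the set does not span, or if it splits as
  \<open>A\<^sub>1 \<union> A\<^sub>2\<close>, then the orthogonal projection onto its span, or onto the span of \<open>A\<^sub>1\<close>, preserves
  orthogonality at all of its points but has a nonzero kernel without being zero.

  Minimality then amounts to linear independence. An independent spanning set has no proper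
  spanning subset. In the other direction, every irreducible spanning set contains an irreducible
  basis (\<open>irreducible_basis_exists\<close>): a maximal irreducible independent subset \<open>B\<close> must span,
  because otherwise irreducibility of the whole set provides a vector outside of \<open>span B\<close> that is
  not orthogonal to \<open>B\<close>, and adding it keeps \<open>B\<close> independent and irreducible.

  The argument is the same over the real and the complex numbers. It is carried out once, for
  a Hermitian form over a field with a conjugation, and then applied to the standard forms.
\<close>

section \<open>Sets that do not split into orthogonal parts\<close>

definition orthogonally_irreducible ::
  "('k::real_normed_field \<Rightarrow> 'v::banach \<Rightarrow> 'v) \<Rightarrow> 'v set \<Rightarrow> bool" where
  "orthogonally_irreducible scl A \<longleftrightarrow>
     (\<forall>A1 A2. A = A1 \<union> A2 \<and> A1 \<noteq> {} \<and> A2 \<noteq> {} \<longrightarrow> \<not> bj_orthogonal_sets scl A1 A2)"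

lemma orthogonally_irreducibleD:
  assumes "orthogonally_irreducible scl A" "A = A1 \<union> A2" "A1 \<noteq> {}" "A2 \<noteq> {}"
  shows "\<not> bj_orthogonal_sets scl A1 A2"
  using assms unfolding orthogonally_irreducible_def by metis

section \<open>Finite-dimensional Hermitian spaces\<close>

text \<open>
  The common setting for both scalar fields: \<open>cj\<close> is the identity on the reals and the conjugation
  on the complex numbers, and \<open>ip\<close> is linear in its first argument.
\<close>

locale hermitian_space = finite_dimensional_vector_space scl Bas
  for scl :: "'k::real_normed_field \<Rightarrow> 'v::banach \<Rightarrow> 'v" and Bas :: "'v set" +
  fixes ip :: "'v \<Rightarrow> 'v \<Rightarrow> 'k" and cj :: "'k \<Rightarrow> 'k"
  assumes ip_add_left: "ip (x + y) z = ip x z + ip y z"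
    and ip_scale_left: "ip (scl c x) z = c * ip x z"
    and ip_commute: "ip y x = cj (ip x y)"
    and ip_self: "ip x x = of_real ((norm x)\<^sup>2)"
    and cj_add: "cj (a + b) = cj a + cj b"
    and cj_mult: "cj (a * b) = cj a * cj b"
    and cj_of_real: "cj (of_real r) = of_real r"
    and mult_cj: "a * cj a = of_real ((norm a)\<^sup>2)"
begin

lemma cj_0 [simp]: "cj 0 = 0"
  using cj_of_real[of 0] by simp

lemma ip_add_right: "ip x (y + z) = ip x y + ip x z"
  by (metis ip_commute ip_add_left cj_add)

lemma ip_scale_right: "ip x (scl c y) = cj c * ip x y"
  by (metis ip_commute ip_scale_left cj_mult)

lemma ip_zero_left [simp]: "ip 0 x = 0"
  using ip_add_left[of 0 0 x] by simp

lemma ip_zero_right [simp]: "ip x 0 = 0"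
  using ip_add_right[of x 0 0] by simp

lemma ip_diff_left: "ip (x - y) z = ip x z - ip y z"
  using ip_add_left[of "x - y" y z] by (simp add: algebra_simps)

lemma ip_diff_right: "ip x (y - z) = ip x y - ip x z"
  using ip_add_right[of x "y - z" z] by (simp add: algebra_simps)

lemma ip_eq_0_commute: "ip x y = 0 \<longleftrightarrow> ip y x = 0"
  by (metis ip_commute cj_0)

lemma ip_self_eq_0: "ip x x = 0 \<longleftrightarrow> x = 0"
  by (simp add: ip_self)

lemma norm_sq_scale: "(norm (scl c x))\<^sup>2 = (norm c * norm x)\<^sup>2"
proof -
  have "of_real ((norm (scl c x))\<^sup>2) = (c * cj c) * ip x x"
    unfolding ip_self[symmetric] ip_scale_left ip_scale_right by (simp only: mult.assoc mult.left_commute)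
  also have "\<dots> = of_real ((norm c * norm x)\<^sup>2)"
    by (simp add: mult_cj ip_self power_mult_distrib)
  finally show ?thesis
    using of_real_eq_iff by blast
qed

lemma norm_scale: "norm (scl c x) = norm c * norm x"
  using norm_sq_scale by (simp add: power2_eq_iff_nonneg)

lemma pythagoras:
  assumes "ip x y = 0"
  shows "(norm (x + y))\<^sup>2 = (norm x)\<^sup>2 + (norm y)\<^sup>2"
proof -
  have "of_real ((norm (x + y))\<^sup>2) = ip x x + ip y y"
    using assms ip_eq_0_commute[of x y]
    by (simp only: ip_self[symmetric] ip_add_left ip_add_right)
      simp
  also have "\<dots> = of_real ((norm x)\<^sup>2 + (norm y)\<^sup>2)"
    by (simp add: ip_self)
  finally show ?thesis
    using of_real_eq_iff by blast
qed

lemma bj_orthogonal_iff_ip: "bj_orthogonal scl x y \<longleftrightarrow> ip x y = 0"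
proof
  assume "ip x y = 0"
  then have "(norm x)\<^sup>2 \<le> (norm (x + scl c y))\<^sup>2" for c
    using pythagoras[of x "scl c y"] by (simp add: ip_scale_right)
  then show "bj_orthogonal scl x y"
    unfolding bj_orthogonal_def by (meson norm_ge_zero power2_le_imp_le)
next
  assume bj: "bj_orthogonal scl x y"
  show "ip x y = 0"
  proof (cases "y = 0")
    case False
    \<comment> \<open>\<open>z\<close> is the component of \<open>x\<close> orthogonal to \<open>y\<close>; it is shorter than \<open>x\<close> unless \<open>x\<close> is
      already orthogonal to \<open>y\<close>.\<close>
    define c where "c = ip x y / ip y y"
    define z where "z = x + scl (- c) y"
    have "ip z y = 0"
      using False by (simp add: z_def c_def ip_diff_left ip_scale_left ip_self_eq_0)
    then have "(norm (z + scl c y))\<^sup>2 = (norm z)\<^sup>2 + (norm (scl c y))\<^sup>2"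
      by (intro pythagoras) (simp add: ip_scale_right)
    moreover have "z + scl c y = x"
      by (simp add: z_def)
    moreover have "(norm x)\<^sup>2 \<le> (norm z)\<^sup>2"
      using bj unfolding bj_orthogonal_def z_def by (intro power_mono) (blast, simp)
    ultimately have "(norm (scl c y))\<^sup>2 \<le> 0"
      by simp
    then have "c = 0"
      using False by (simp add: norm_scale)
    then show ?thesis
      using False by (simp add: c_def ip_self_eq_0)
  qed simp
qed

lemma ip_span_left_eq_0:
  assumes "\<And>s. s \<in> S \<Longrightarrow> ip s y = 0" and "x \<in> span S"
  shows "ip x y = 0"
  using assms(2)
  by (induction rule: span_induct_alt) (auto simp: ip_add_left ip_scale_left assms(1))

section \<open>Orthogonal projections\<close>

text \<open>The Gram-Schmidt step, by induction on a finite set: the projection onto the span of one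
  further vector \<open>a\<close> is added in the direction \<open>e\<close> of the component of \<open>a\<close> orthogonal to the
  previous span.\<close>

lemma orthogonal_projection_finite:
  assumes "finite S"
  shows "\<exists>P. Vector_Spaces.linear scl scl P \<and>
    (\<forall>x. P x \<in> span S) \<and> (\<forall>x. \<forall>s\<in>S. ip s (x - P x) = 0)"
  using assms
proof (induction S)
  case empty
  have "Vector_Spaces.linear scl scl (\<lambda>x. 0)"
    by unfold_locales auto
  then show ?case
    by (intro exI[of _ "\<lambda>x. 0"]) auto
next
  case (insert a S)
  then obtain P where P: "Vector_Spaces.linear scl scl P"
    and P_span: "\<And>x. P x \<in> span S" and P_orth: "\<And>x s. s \<in> S \<Longrightarrow> ip s (x - P x) = 0"
    by blast
  interpret P: Vector_Spaces.linear scl scl P by (rule P)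
  define e where "e = a - P a"
  have e_orth: "ip w e = 0" if "w \<in> span S" for w
    using ip_span_left_eq_0[OF _ that] P_orth e_def by blast
  have P_orth_span: "ip w (x - P x) = 0" if "w \<in> span S" for w x
    using ip_span_left_eq_0[OF _ that] P_orth by blast
  show ?case
  proof (cases "e = 0")
    case True
    then have "a \<in> span S"
      using P_span[of a] by (simp add: e_def)
    then have "\<forall>x. \<forall>s\<in>insert a S. ip s (x - P x) = 0"
      using P_orth P_orth_span by blast
    moreover have "\<forall>x. P x \<in> span (insert a S)"
      using P_span span_mono[of S "insert a S"] by blast
    ultimately show ?thesis
      using P by blast
  next
    case False
    define Q where "Q x = P x + scl (ip x e / ip e e) e" for x
    have "Vector_Spaces.linear scl scl Q"
      by unfold_locales
        (auto simp: Q_def P.add P.scale ip_add_left ip_scale_left add_divide_distrib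
          scale_left_distrib scale_right_distrib)
    moreover have "Q x \<in> span (insert a S)" for x
    proof -
      have P_insert: "P y \<in> span (insert a S)" for y
        using P_span span_mono[of S "insert a S"] by blast
      have "e \<in> span (insert a S)"
        unfolding e_def by (rule span_diff[OF span_base P_insert]) simp
      then show ?thesis
        unfolding Q_def using P_insert span_add span_scale by blast
    qed
    moreover have "ip s (x - Q x) = 0" if "s \<in> insert a S" for s x
    proof -
      have S: "ip w (x - Q x) = 0" if "w \<in> span S" for w
        using P_orth_span[OF that, of x] e_orth[OF that]
        by (simp add: Q_def ip_diff_right ip_add_right ip_scale_right)
      have "ip (x - Q x) e = 0"
        using False e_orth[OF P_span[of x]]
        by (simp add: Q_def ip_diff_left ip_add_left ip_scale_left ip_self_eq_0)
      then have "ip (e + P a) (x - Q x) = 0"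
        using S[OF P_span] ip_eq_0_commute by (simp add: ip_add_left)
      then show ?thesis
        using that S span_base by (auto simp: e_def)
    qed
    ultimately show ?thesis
      by blast
  qed
qed

lemma orthogonal_projection_exists:
  obtains P where "Vector_Spaces.linear scl scl P"
    and "\<And>x. P x \<in> span S" and "\<And>x s. s \<in> span S \<Longrightarrow> ip s (x - P x) = 0"
proof -
  obtain B where B: "B \<subseteq> S" "independent B" "S \<subseteq> span B"
    using maximal_independent_subset by blast
  have spB: "span B = span S"
    using B by (metis span_mono span_span subset_antisym)
  have "finite B"
    using B(2) finiteI_independent by blast
  from orthogonal_projection_finite[OF this] obtain P
    where P: "Vector_Spaces.linear scl scl P" "\<And>x. P x \<in> span B"
      "\<And>x s. s \<in> B \<Longrightarrow> ip s (x - P x) = 0"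
    by blast
  show ?thesis
  proof
    show "ip s (x - P x) = 0" if "s \<in> span S" for x s
      using ip_span_left_eq_0[of B "x - P x" s] P(3) that spB by blast
  qed (use P spB in auto)
qed

text \<open>The source of counterexamples: the orthogonal projection onto \<open>span S\<close> preserves orthogonality
  at the vectors of its range and of its kernel, but is not a multiple of an isometry as soon as
  both are nonzero.\<close>

lemma K_set_not_split_by_subspace:
  assumes K: "K_set scl A"
    and split: "\<And>a. a \<in> A \<Longrightarrow> a \<in> span S \<or> (\<forall>s\<in>S. ip s a = 0)"
    and u: "u \<in> span S" "u \<noteq> 0"
    and v: "v \<noteq> 0" "\<forall>s\<in>S. ip s v = 0"
  shows False
proof -
  obtain P where P: "Vector_Spaces.linear scl scl P"
    and P_span: "\<And>x. P x \<in> span S" and P_orth: "\<And>x s. s \<in> span S \<Longrightarrow> ip s (x - P x) = 0"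
    using orthogonal_projection_exists[of S] by blast
  have fix_span: "P x = x" if "x \<in> span S" for x
    using P_orth[of "x - P x" x] P_span that span_diff ip_self_eq_0 by auto
  have kernel: "P x = 0" if "\<forall>s\<in>S. ip s x = 0" for x
  proof -
    have "ip (P x) x = 0"
      using ip_span_left_eq_0[of S x "P x"] that P_span by blast
    then show ?thesis
      using P_orth[OF P_span[of x], of x] ip_self_eq_0 by (simp add: ip_diff_right)
  qed
  have "norm (P x) \<le> 1 * norm x" for x
  proof -
    have "(norm (P x + (x - P x)))\<^sup>2 = (norm (P x))\<^sup>2 + (norm (x - P x))\<^sup>2"
      by (intro pythagoras P_orth P_span)
    then have "(norm (P x))\<^sup>2 \<le> (norm x)\<^sup>2"
      by simp
    then show ?thesis
      using power2_le_imp_le by auto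
  qed
  then have "bounded_operator scl P"
    using P unfolding bounded_operator_def by blast
  moreover have "preserves_bj_at scl P a" if "a \<in> A" for a
    unfolding preserves_bj_at_def bj_orthogonal_iff_ip
  proof (intro allI impI)
    fix y assume y: "ip a y = 0"
    show "ip (P a) (P y) = 0"
      using split[OF that]
    proof
      assume "a \<in> span S"
      then show ?thesis
        using y P_orth[of a y] by (simp add: fix_span ip_diff_right)
    next
      assume "\<forall>s\<in>S. ip s a = 0"
      then show ?thesis by (simp add: kernel)
    qed
  qed
  ultimately have "scalar_multiple_of_isometry scl P"
    using K unfolding K_set_def by blast
  then obtain c U where U: "linear_isometry scl U" "P = (\<lambda>x. scl c (U x))"
    unfolding scalar_multiple_of_isometry_def by blast
  then have norm_P: "norm (P x) = norm c * norm x" for x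
    unfolding linear_isometry_def by (simp add: norm_scale)
  have "c = 0"
    using norm_P[of v] kernel[of v] v by simp
  then show False
    using norm_P[of u] fix_span[of u] u by simp
qed

section \<open>Characterization of the K-sets\<close>

text \<open>With \<open>\<parallel>x\<parallel> = 1\<close>, subtracting from \<open>y\<close> its component along \<open>x\<close> leaves a vector orthogonal to \<open>x\<close>,
  whose image is orthogonal to \<open>T x\<close>. So \<open>x\<close> is an eigenvector of \<open>T\<^sup>* T\<close>, without
  mention of the adjoint.\<close>

lemma preserves_bj_at_imp_eigenvector:
  assumes T: "Vector_Spaces.linear scl scl T" and "preserves_bj_at scl T x" and "norm x = 1"
  shows "ip (T x) (T y) = of_real ((norm (T x))\<^sup>2) * ip x y"
proof -
  interpret T: Vector_Spaces.linear scl scl T by (rule T)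
  define z where "z = y - scl (ip y x) x"
  have "ip z x = 0"
    using assms(3) by (simp add: z_def ip_diff_left ip_scale_left ip_self)
  then have "ip x z = 0"
    using ip_eq_0_commute by blast
  then have "ip (T x) (T z) = 0"
    using assms(2) unfolding preserves_bj_at_def bj_orthogonal_iff_ip by blast
  then have "ip (T x) (T y) = cj (ip y x) * ip (T x) (T x)"
    by (simp add: z_def T.diff T.scale ip_diff_right ip_scale_right)
  then show ?thesis
    by (simp add: ip_commute[of x y, symmetric] ip_self mult.commute)
qed

text \<open>Eigenvectors that are not orthogonal have the same eigenvalue.\<close>

lemma preserves_bj_at_norm_eq:
  assumes T: "Vector_Spaces.linear scl scl T"
    and x: "preserves_bj_at scl T x" "norm x = 1"
    and y: "preserves_bj_at scl T y" "norm y = 1"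
    and "ip x y \<noteq> 0"
  shows "norm (T x) = norm (T y)"
proof -
  have "of_real ((norm (T x))\<^sup>2) * ip x y = ip (T x) (T y)"
    using preserves_bj_at_imp_eigenvector[OF T x] by simp
  also have "\<dots> = cj (of_real ((norm (T y))\<^sup>2) * ip y x)"
    using preserves_bj_at_imp_eigenvector[OF T y, of x] by (metis ip_commute)
  also have "\<dots> = of_real ((norm (T y))\<^sup>2) * ip x y"
    by (simp only: cj_mult cj_of_real ip_commute[of x y, symmetric])
  finally have "(norm (T x))\<^sup>2 = (norm (T y))\<^sup>2"
    using assms(6) of_real_eq_iff by (metis mult_right_cancel)
  then show ?thesis
    by (simp add: power2_eq_iff_nonneg)
qed

text \<open>For \<open>r = 0\<close> the operator is zero, and the isometry is taken to be the identity.\<close>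

lemma norm_eq_imp_scalar_multiple_of_isometry:
  assumes T: "Vector_Spaces.linear scl scl T" and norm_T: "\<And>x. norm (T x) = r * norm x"
  shows "scalar_multiple_of_isometry scl T"
proof (cases "r = 0")
  case True
  then have "T = (\<lambda>x. scl 0 x)"
    using norm_T by auto
  moreover have "linear_isometry scl (\<lambda>x. x)"
    unfolding linear_isometry_def using linear_ident by auto
  ultimately show ?thesis
    unfolding scalar_multiple_of_isometry_def by blast
next
  case False
  interpret T: Vector_Spaces.linear scl scl T by (rule T)
  define U where "U x = scl (inverse (of_real r)) (T x)" for x
  have "Vector_Spaces.linear scl scl U"
    by unfold_locales (auto simp: U_def T.add T.scale scale_right_distrib mult.commute)
  moreover have "norm (U x) = norm x" for x
  proof (cases "x = 0")
    case nz: False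
    have "r * norm x \<ge> 0"
      using norm_T[of x] by (metis norm_ge_zero)
    then have "r > 0"
      using False nz by (simp add: zero_le_mult_iff)
    then show ?thesis
      by (simp add: U_def norm_scale norm_T norm_inverse)
  qed (simp add: U_def T.zero)
  ultimately have "linear_isometry scl U"
    unfolding linear_isometry_def by blast
  moreover have "T = (\<lambda>x. scl (of_real r) (U x))"
    using False by (simp add: U_def)
  ultimately show ?thesis
    unfolding scalar_multiple_of_isometry_def by blast
qed

lemma irreducible_spanning_imp_K_set:
  assumes A: "A \<noteq> {}" "A \<subseteq> sphere 0 1"
    and irr: "orthogonally_irreducible scl A" and sp: "span A = UNIV"
  shows "K_set scl A"
  unfolding K_set_def
proof (intro conjI allI impI)
  fix T assume "bounded_operator scl T \<and> (\<forall>x\<in>A. preserves_bj_at scl T x)"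
  then have T: "Vector_Spaces.linear scl scl T" and pres: "\<And>x. x \<in> A \<Longrightarrow> preserves_bj_at scl T x"
    unfolding bounded_operator_def by auto
  interpret T: Vector_Spaces.linear scl scl T by (rule T)
  have unit: "norm x = 1" if "x \<in> A" for x
    using A(2) that by auto
  obtain a where a: "a \<in> A"
    using A(1) by blast
  \<comment> \<open>The vectors of \<open>A\<close> whose eigenvalue is that of \<open>a\<close> are orthogonal to the other ones, of which
    there are none by irreducibility.\<close>
  define r where "r = norm (T a)"
  define A1 where "A1 = {x \<in> A. norm (T x) = r}"
  have "bj_orthogonal_sets scl A1 (A - A1)"
    unfolding bj_orthogonal_sets_def bj_orthogonal_iff_ip
    using preserves_bj_at_norm_eq[OF T] pres unit by (fastforce simp: A1_def)
  moreover have "A = A1 \<union> (A - A1)" "A1 \<noteq> {}"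
    using a by (auto simp: A1_def r_def)
  ultimately have "A - A1 = {}"
    using orthogonally_irreducibleD[OF irr] by metis
  then have on_A: "ip (T x) (T y) = of_real (r\<^sup>2) * ip x y" if "x \<in> A" for x y
    using preserves_bj_at_imp_eigenvector[OF T pres unit] that by (auto simp: A1_def)
  have "ip (T x) (T y) = of_real (r\<^sup>2) * ip x y" for x y
  proof -
    have "x \<in> span A" using sp by simp
    then show ?thesis
      by (induction rule: span_induct_alt)
        (simp_all add: T.zero T.add T.scale ip_add_left ip_scale_left on_A algebra_simps)
  qed
  then have "(of_real ((norm (T x))\<^sup>2) :: 'k) = of_real ((r * norm x)\<^sup>2)" for x
    by (simp only: ip_self[symmetric]) (simp add: ip_self power_mult_distrib)
  then have "(norm (T x))\<^sup>2 = (r * norm x)\<^sup>2" for x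
    using of_real_eq_iff by blast
  then have "norm (T x) = r * norm x" for x
    by (rule power2_eq_imp_eq) (simp_all add: r_def)
  then show "scalar_multiple_of_isometry scl T"
    using norm_eq_imp_scalar_multiple_of_isometry[OF T] by blast
qed (use A in auto)

lemma K_set_imp_span_UNIV:
  assumes K: "K_set scl A"
  shows "span A = UNIV"
proof (rule ccontr)
  assume "span A \<noteq> UNIV"
  then obtain w where w: "w \<notin> span A" by blast
  obtain P where "Vector_Spaces.linear scl scl P"
    and P: "\<And>x. P x \<in> span A" "\<And>x s. s \<in> span A \<Longrightarrow> ip s (x - P x) = 0"
    using orthogonal_projection_exists[of A] by blast
  obtain a where a: "a \<in> A"
    using K unfolding K_set_def by blast
  then have "norm a = 1"
    using K unfolding K_set_def by auto
  then have "a \<noteq> 0"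
    by auto
  show False
  proof (rule K_set_not_split_by_subspace[OF K, of A a "w - P w"])
    show "w - P w \<noteq> 0"
      using w P(1)[of w] by auto
    show "\<forall>s\<in>A. ip s (w - P w) = 0"
      using P(2) span_base by blast
  qed (use a \<open>a \<noteq> 0\<close> span_base in auto)
qed

lemma K_set_imp_irreducible:
  assumes K: "K_set scl A"
  shows "orthogonally_irreducible scl A"
  unfolding orthogonally_irreducible_def
proof (intro allI impI notI)
  fix A1 A2 assume A: "A = A1 \<union> A2 \<and> A1 \<noteq> {} \<and> A2 \<noteq> {}" and "bj_orthogonal_sets scl A1 A2"
  then have orth: "\<forall>u\<in>A1. \<forall>v\<in>A2. ip u v = 0"
    unfolding bj_orthogonal_sets_def bj_orthogonal_iff_ip by blast
  obtain u v where uv: "u \<in> A1" "v \<in> A2"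
    using A by blast
  have "x \<noteq> 0" if "x \<in> A" for x
    using K that unfolding K_set_def by auto
  then have "u \<noteq> 0" "v \<noteq> 0"
    using uv A by auto
  then show False
    using K_set_not_split_by_subspace[OF K, of A1 u v] A orth uv span_base by blast
qed

lemma K_set_iff:
  assumes "A \<noteq> {}" "A \<subseteq> sphere 0 1"
  shows "K_set scl A \<longleftrightarrow> orthogonally_irreducible scl A \<and> span A = UNIV"
  using irreducible_spanning_imp_K_set[OF assms] K_set_imp_irreducible[of A]
    K_set_imp_span_UNIV[of A] by argo

section \<open>Minimal K-sets are irreducible bases\<close>

lemma irreducible_singleton:
  assumes "a \<noteq> 0"
  shows "orthogonally_irreducible scl {a}"
  unfolding orthogonally_irreducible_def bj_orthogonal_sets_def bj_orthogonal_iff_ip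
proof (intro allI impI notI)
  fix A1 A2 assume A: "{a} = A1 \<union> A2 \<and> A1 \<noteq> {} \<and> A2 \<noteq> {}"
    and orth: "\<forall>u\<in>A1. \<forall>v\<in>A2. ip u v = 0"
  have "A1 \<subseteq> {a}" "A2 \<subseteq> {a}"
    using A by simp_all
  then have "a \<in> A1" "a \<in> A2"
    using A subset_singletonD by fastforce+
  then show False
    using orth assms ip_self_eq_0 by blast
qed

text \<open>A splitting of \<open>insert a B\<close> either splits \<open>B\<close> or separates \<open>a\<close> from \<open>B\<close>.\<close>

lemma irreducible_insert:
  assumes irr: "orthogonally_irreducible scl B" and b: "b \<in> B" "ip a b \<noteq> 0"
  shows "orthogonally_irreducible scl (insert a B)"
  unfolding orthogonally_irreducible_def
proof (intro allI impI notI)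
  fix A1 A2 assume A: "insert a B = A1 \<union> A2 \<and> A1 \<noteq> {} \<and> A2 \<noteq> {}"
    and "bj_orthogonal_sets scl A1 A2"
  then have orth: "\<And>u v. u \<in> A1 \<Longrightarrow> v \<in> A2 \<Longrightarrow> ip u v = 0"
    unfolding bj_orthogonal_sets_def bj_orthogonal_iff_ip by blast
  have "bj_orthogonal_sets scl (A1 \<inter> B) (A2 \<inter> B)"
    using orth unfolding bj_orthogonal_sets_def bj_orthogonal_iff_ip by blast
  moreover have "B = (A1 \<inter> B) \<union> (A2 \<inter> B)"
    using A by blast
  ultimately have "A1 \<inter> B = {} \<or> A2 \<inter> B = {}"
    using orthogonally_irreducibleD[OF irr] by metis
  \<comment> \<open>One of the parts is \<open>{a}\<close>, and the other contains \<open>b\<close>.\<close>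
  then show False
  proof
    assume "A1 \<inter> B = {}"
    then have "b \<in> A2" "A1 \<subseteq> {a}"
      using A b(1) by auto
    then show False
      using A orth[of a b] b(2) by blast
  next
    assume "A2 \<inter> B = {}"
    then have "b \<in> A1" "A2 \<subseteq> {a}"
      using A b(1) by auto
    then show False
      using A orth[of b a] b(2) ip_eq_0_commute[of a b] by blast
  qed
qed

text \<open>A maximal irreducible independent subset \<open>B\<close> spans: otherwise \<open>A \<inter> span B\<close> and
  \<open>A - span B\<close> are nonempty, hence not orthogonal, so some vector of \<open>A - span B\<close> is not orthogonal
  to \<open>B\<close> and could be added to \<open>B\<close>.\<close>

lemma irreducible_basis_exists:
  assumes A: "A \<noteq> {}" "A \<subseteq> sphere 0 1"
    and irr: "orthogonally_irreducible scl A" and sp: "span A = UNIV"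
  obtains B where "B \<subseteq> A" "B \<noteq> {}" "independent B" "orthogonally_irreducible scl B" "span B = UNIV"
proof -
  define Q where "Q B \<longleftrightarrow> B \<subseteq> A \<and> B \<noteq> {} \<and> independent B \<and> orthogonally_irreducible scl B" for B
  obtain a where "a \<in> A"
    using A(1) by blast
  moreover from this have "a \<noteq> 0"
    using A(2) by auto
  ultimately have "Q {a}"
    unfolding Q_def using irreducible_singleton independent_insert[of a "{}"] by auto
  moreover have "\<forall>B. Q B \<longrightarrow> card B < Suc dimension"
    unfolding Q_def using independent_card_le_dim[of _ UNIV] dim_UNIV
    by (auto simp: less_Suc_eq_le dimension_def)
  ultimately obtain B where B: "Q B" and max: "\<And>C. Q C \<Longrightarrow> card C \<le> card B"
    using ex_has_greatest_nat[of Q "{a}" card "Suc dimension"] by auto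
  have "A \<subseteq> span B"
  proof (rule ccontr)
    assume "\<not> A \<subseteq> span B"
    then have "A - span B \<noteq> {}"
      by blast
    moreover have "A \<inter> span B \<noteq> {}"
      using B span_base unfolding Q_def by blast
    ultimately have "\<not> bj_orthogonal_sets scl (A \<inter> span B) (A - span B)"
      by (intro orthogonally_irreducibleD[OF irr]) auto
    then obtain u v where uv: "u \<in> span B" "v \<in> A" "v \<notin> span B" "ip u v \<noteq> 0"
      unfolding bj_orthogonal_sets_def bj_orthogonal_iff_ip by blast
    then obtain b where b: "b \<in> B" "ip b v \<noteq> 0"
      using ip_span_left_eq_0[of B v u] by blast
    then have "ip v b \<noteq> 0"
      using ip_eq_0_commute by blast
    then have "orthogonally_irreducible scl (insert v B)"
      using B b(1) irreducible_insert[of B b v] unfolding Q_def by blast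
    moreover have "independent (insert v B)"
      using B uv(3) independent_insert unfolding Q_def by auto
    ultimately have "Q (insert v B)"
      using B uv unfolding Q_def by blast
    then have "card (insert v B) \<le> card B"
      by (rule max)
    moreover have "v \<notin> B" "finite B"
      using uv(3) span_base B finiteI_independent unfolding Q_def by auto
    ultimately show False
      by simp
  qed
  then have "span B = UNIV"
    using sp by (metis span_mono span_span top.extremum_uniqueI)
  then show ?thesis
    using that B unfolding Q_def by blast
qed

text \<open>A minimal K-set equals the irreducible basis that it contains. A proper subset of a basis
  does not span, so it is not a K-set.\<close>

theorem minimal_K_set_iff:
  assumes A: "A \<noteq> {}" "A \<subseteq> sphere 0 1"
  shows "minimal_K_set scl A \<longleftrightarrow>
    independent A \<and> card A = dimension \<and> orthogonally_irreducible scl A"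
proof
  assume min: "minimal_K_set scl A"
  then have "K_set scl A"
    unfolding minimal_K_set_def by blast
  then have "orthogonally_irreducible scl A" "span A = UNIV"
    using K_set_iff[OF A] by simp_all
  then obtain B where B: "B \<subseteq> A" "B \<noteq> {}" "independent B" "orthogonally_irreducible scl B"
      "span B = UNIV"
    by (rule irreducible_basis_exists[OF A])
  have "K_set scl B"
    using K_set_iff[of B] B A(2) by (metis subset_trans)
  then have "B = A"
    using min B(1) unfolding minimal_K_set_def by metis
  moreover have "card B = dimension"
    using B dim_eq_card[of B UNIV] by (simp add: dimension_def)
  ultimately show "independent A \<and> card A = dimension \<and> orthogonally_irreducible scl A"
    using B(3,4) by simp
next
  assume R: "independent A \<and> card A = dimension \<and> orthogonally_irreducible scl A"
  then have "UNIV \<subseteq> span A"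
    by (intro card_ge_dim_independent) (simp_all add: dimension_def)
  then have "K_set scl A"
    using R K_set_iff[OF A] by (simp add: top.extremum_unique)
  moreover have "B = A" if B: "B \<subseteq> A" "K_set scl B" for B
  proof (rule ccontr)
    assume "B \<noteq> A"
    then obtain x where x: "x \<in> A" "x \<notin> B"
      using B(1) by auto
    have "span B \<subseteq> span (A - {x})"
      using B(1) x(2) by (intro span_mono) auto
    then have "x \<in> span (A - {x})"
      using K_set_imp_span_UNIV[OF B(2)] by auto
    then show False
      using R x(1) unfolding dependent_def by auto
  qed
  ultimately show "minimal_K_set scl A"
    unfolding minimal_K_set_def by auto
qed

end

section \<open>The standard real and complex Hilbert spaces\<close>

lemma norm_vec_sq: "(norm x)\<^sup>2 = (\<Sum>i\<in>UNIV. (norm (x $ i))\<^sup>2)"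
  for x :: "'a::real_normed_vector ^ 'n"
  by (simp add: norm_vec_def L2_set_def sum_nonneg)

interpretation real_vec: hermitian_space "(*s)" cart_basis
  "\<lambda>x y :: real ^ 'n. \<Sum>i\<in>UNIV. x $ i * y $ i" "\<lambda>a. a"
  by unfold_locales
    (simp_all add: norm_vec_sq sum.distrib sum_distrib_left algebra_simps
      flip: power2_eq_square)

interpretation complex_vec: hermitian_space "(*s)" cart_basis
  "\<lambda>x y :: complex ^ 'n. \<Sum>i\<in>UNIV. x $ i * cnj (y $ i)" cnj
  by unfold_locales
    (simp_all add: norm_vec_sq sum.distrib sum_distrib_left algebra_simps
      complex_norm_square[unfolded of_real_power])

lemma eq_inj_range_iff_card:
  "(\<exists>x :: 'n::finite \<Rightarrow> 'a. inj x \<and> A = range x) \<longleftrightarrow> card A = CARD('n)"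
proof
  assume "card A = CARD('n)"
  moreover from this have "finite A"
    by (metis card.infinite zero_less_card_finite less_irrefl)
  ultimately obtain f :: "'n \<Rightarrow> 'a" where "bij_betw f UNIV A"
    using finite_same_card_bij[of "UNIV :: 'n set" A] by auto
  then show "\<exists>x :: 'n \<Rightarrow> 'a. inj x \<and> A = range x"
    by (auto simp: bij_betw_def)
qed (auto simp: card_image)

lemma independent_family_iff_card:
  fixes A :: "('a::field ^ 'n) set"
  shows "(\<exists>x :: 'n \<Rightarrow> 'a ^ 'n. inj x \<and> A = range x \<and> vec.independent (range x)) \<longleftrightarrow>
    vec.independent A \<and> card A = vec.dimension TYPE('a) TYPE('n)"
  using eq_inj_range_iff_card[of A, where 'n = 'n] card_cart_basis unfolding vec.dimension_def
  by metis

theorem theorem2p4: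
  shows "(\<forall>A :: (real ^ 'n) set. A \<noteq> {} \<and> A \<subseteq> sphere 0 1 \<longrightarrow>
            (minimal_K_set (*s) A \<longleftrightarrow>
               (\<exists>x :: 'n \<Rightarrow> real ^ 'n. inj x \<and> A = range x \<and> vec.independent (range x)) \<and>
               (\<forall>A1 A2. A = A1 \<union> A2 \<and> A1 \<noteq> {} \<and> A2 \<noteq> {} \<longrightarrow>
                  \<not> bj_orthogonal_sets (*s) A1 A2)))
       \<and> (\<forall>A :: (complex ^ 'n) set. A \<noteq> {} \<and> A \<subseteq> sphere 0 1 \<longrightarrow>
            (minimal_K_set (*s) A \<longleftrightarrow>
               (\<exists>x :: 'n \<Rightarrow> complex ^ 'n. inj x \<and> A = range x \<and> vec.independent (range x)) \<and>
               (\<forall>A1 A2. A = A1 \<union> A2 \<and> A1 \<noteq> {} \<and> A2 \<noteq> {} \<longrightarrow>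
                  \<not> bj_orthogonal_sets (*s) A1 A2)))"
  unfolding independent_family_iff_card orthogonally_irreducible_def[symmetric]
  using real_vec.minimal_K_set_iff complex_vec.minimal_K_set_iff by metis

end
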